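(* Let $\{B^H(t),~t\ge 0\}$ be a continuous modification of a fractional Brownian motion with Hurst index $H>\frac{1}{2}$ (so $H\in(\frac12,1)$), and let $Y(0), b, \sigma > 0$ be given constants. For any $\varepsilon > 0$, consider the square root process $Y^H_\varepsilon = \{Y^H_{\varepsilon}(t),~t\ge 0\}$ given by \[ Y^H_\varepsilon (t) = Y(0) + \frac{1}{2} \int_0^t\left( \frac{\varepsilon}{Y^H_\varepsilon(s)} - b Y^H_\varepsilon(s) \right)ds + \frac{\sigma}{2} B^H(t), \quad t\ge 0. \] Then, with probability 1, 1) the limit $\lim_{\varepsilon \downarrow 0} Y^H_\varepsilon(t) =: Y^H(t)$ is well-defined, finite and non-negative for any $t\ge 0$; 2) the limit process $Y^H = \{Y^H(t),~t\ge 0\}$ is a reflected fractional Ornstein-Uhlenbeck process satisfying \[ Y^H(t) = Y(0) - \frac{b}{2} \int_0^t Y^H(s) ds + \frac{\sigma}{2} B^H(t) + L^H(t),\quad t\ge 0, \] where $L^H$ is the reflection function for $Y^H$; 3) for any $T>0$ \[ \sup_{t\in[0,T]} |Y^H(t) - Y^H_\varepsilon(t)| \to 0, \quad \varepsilon \downarrow 0, \] and \[ \sup_{t\in[0,T]} \left|L^H(t) - \frac{1}{2}\int_0^t \frac{\varepsilon}{Y^H_\varepsilon(s)}ds\right| \to 0, \quad \varepsilon \downarrow 0. \]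
   Context: The process $Y^H_\varepsilon$ denotes the pathwise solution of its equation with $Y^H_\varepsilon(t)>0$ for all $t\ge 0$. It is a known fact that, for $H>\frac12$ and constants $Y(0),\varepsilon,b,\sigma>0$, such a solution exists and is unique for every $\omega\in\Omega$ for which $t\mapsto B^H(\omega,t)$ is locally H\"older continuous; in particular the almost sure event on which the solutions exist does not depend on $Y(0),\varepsilon,b,\sigma$. (The square $X^H_\varepsilon=(Y^H_\varepsilon)^2$ is called a fractional Cox-Ingersoll-Ross process.) Reflection function: a process $\zeta=\{\zeta(t),~t\ge0\}$ is called a reflection function for a stochastic process $\xi=\{\xi(t),~t\ge 0\}$ if, with probability 1, $\zeta$ is a continuous non-decreasing process such that $\zeta(0)=0$ and the points of growth of $\zeta$ can occur only at zeros of $\xi$. Reflected fractional Ornstein-Uhlenbeck (RFOU) process: a stochastic process $\widetilde Y^H=\{\widetilde Y^H(t),~t\ge 0\}$ with $\widetilde Y^H\ge 0$ a.s. satisfying \[ \widetilde Y^H(t) = Y(0) - \widetilde{b} \int_0^t \widetilde Y^H(s) ds + \widetilde{\sigma} B^H(t) + \widetilde L^H(t),\quad t\ge 0, \] where $Y(0),\widetilde b,\widetilde\sigma$ are positive constants, $B^H$ is a fractional Brownian motion and $\widetilde L^H$ is a reflection function for $\widetilde Y^H$. *)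

theory Defs
  imports "HOL-Probability.Probability"
begin

text \<open>Processes are indexed by time first: \<open>X t \<omega>\<close>. Only times \<open>t \<ge> 0\<close> are ever constrained.\<close>

definition stochastic_process :: "'a measure \<Rightarrow> (real \<Rightarrow> 'a \<Rightarrow> real) \<Rightarrow> bool" where
  "stochastic_process M X \<longleftrightarrow> (\<forall>t\<ge>0. X t \<in> borel_measurable M)"

text \<open>Point masses count as (degenerate) Gaussian laws; \<open>normal_density\<close> only covers
  positive variance.\<close>

definition gaussian_rv :: "'a measure \<Rightarrow> ('a \<Rightarrow> real) \<Rightarrow> bool" where
  "gaussian_rv M X \<longleftrightarrow> X \<in> borel_measurable M \<and>
     ((\<exists>m s. s > 0 \<and> distributed M lborel X (normal_density m s)) \<or>
      (\<exists>m. AE \<omega> in M. X \<omega> = m))"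

text \<open>All finite-dimensional distributions are Gaussian, i.e. every linear combination of
  finitely many marginals is Gaussian.\<close>

definition gaussian_process :: "'a measure \<Rightarrow> (real \<Rightarrow> 'a \<Rightarrow> real) \<Rightarrow> bool" where
  "gaussian_process M X \<longleftrightarrow> stochastic_process M X \<and>
     (\<forall>F c. finite F \<longrightarrow> F \<subseteq> {0..} \<longrightarrow> gaussian_rv M (\<lambda>\<omega>. \<Sum>t\<in>F. c t * X t \<omega>))"

definition fractional_brownian_motion ::
    "'a measure \<Rightarrow> real \<Rightarrow> (real \<Rightarrow> 'a \<Rightarrow> real) \<Rightarrow> bool" where
  "fractional_brownian_motion M H B \<longleftrightarrow> 0 < H \<and> H < 1 \<and> gaussian_process M B \<and>
     (\<forall>t\<ge>0. (\<integral>\<omega>. B t \<omega> \<partial>M) = 0) \<and>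
     (\<forall>s\<ge>0. \<forall>t\<ge>0. (\<integral>\<omega>. B s \<omega> * B t \<omega> \<partial>M) =
        (s powr (2 * H) + t powr (2 * H) - \<bar>t - s\<bar> powr (2 * H)) / 2)"

text \<open>Path continuity is only required almost surely, which subsumes the convention that all
  paths are continuous.\<close>

definition continuous_modification ::
    "'a measure \<Rightarrow> (real \<Rightarrow> 'a \<Rightarrow> real) \<Rightarrow> (real \<Rightarrow> 'a \<Rightarrow> real) \<Rightarrow> bool" where
  "continuous_modification M X X' \<longleftrightarrow> stochastic_process M X' \<and>
     (\<forall>t\<ge>0. AE \<omega> in M. X' t \<omega> = X t \<omega>) \<and>
     (AE \<omega> in M. continuous_on {0..} (\<lambda>t. X' t \<omega>))"

text \<open>A positive pathwise solution \<open>y\<close> of the square root equation driven by the path \<open>\<beta>\<close>.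
  Integrability is stated because the integral of a non-integrable function is \<open>0\<close> by convention;
  together with the equation it makes \<open>y\<close> continuous whenever \<open>\<beta>\<close> is.\<close>

definition sqrt_equation_solution ::
    "real \<Rightarrow> real \<Rightarrow> real \<Rightarrow> real \<Rightarrow> (real \<Rightarrow> real) \<Rightarrow> (real \<Rightarrow> real) \<Rightarrow> bool" where
  "sqrt_equation_solution y0 b \<sigma> \<epsilon> \<beta> y \<longleftrightarrow>
     (\<forall>t\<ge>0. y t > 0 \<and> (\<lambda>s. \<epsilon> / y s - b * y s) integrable_on {0..t} \<and>
        y t = y0 + 1/2 * integral {0..t} (\<lambda>s. \<epsilon> / y s - b * y s) + \<sigma> / 2 * \<beta> t)"

text \<open>\<open>max 0\<close> keeps the left end of the neighbourhood inside the time domain, so that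
  \<open>0\<close> is a point of growth iff \<open>f\<close> increases immediately to its right.\<close>

definition point_of_growth :: "(real \<Rightarrow> real) \<Rightarrow> real \<Rightarrow> bool" where
  "point_of_growth f t \<longleftrightarrow> t \<ge> 0 \<and> (\<forall>\<delta>>0. f (max 0 (t - \<delta>)) < f (t + \<delta>))"

definition reflection_function ::
    "'a measure \<Rightarrow> (real \<Rightarrow> 'a \<Rightarrow> real) \<Rightarrow> (real \<Rightarrow> 'a \<Rightarrow> real) \<Rightarrow> bool" where
  "reflection_function M \<zeta> \<xi> \<longleftrightarrow> stochastic_process M \<zeta> \<and>
     (AE \<omega> in M. continuous_on {0..} (\<lambda>t. \<zeta> t \<omega>) \<and> mono_on {0..} (\<lambda>t. \<zeta> t \<omega>) \<and>
        \<zeta> 0 \<omega> = 0 \<and> (\<forall>t. point_of_growth (\<lambda>u. \<zeta> u \<omega>) t \<longrightarrow> \<xi> t \<omega> = 0))"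

text \<open>\<open>Y\<close> is a reflected fractional Ornstein-Uhlenbeck process with parameters \<open>y0, b, \<sigma>\<close>,
  driven by the fractional Brownian motion \<open>B\<close>, with reflection function \<open>L\<close>.\<close>

definition RFOU_process ::
    "'a measure \<Rightarrow> real \<Rightarrow> (real \<Rightarrow> 'a \<Rightarrow> real) \<Rightarrow> real \<Rightarrow> real \<Rightarrow> real \<Rightarrow>
     (real \<Rightarrow> 'a \<Rightarrow> real) \<Rightarrow> (real \<Rightarrow> 'a \<Rightarrow> real) \<Rightarrow> bool" where
  "RFOU_process M H B y0 b \<sigma> Y L \<longleftrightarrow>
     y0 > 0 \<and> b > 0 \<and> \<sigma> > 0 \<and>
     fractional_brownian_motion M H B \<and> stochastic_process M Y \<and> reflection_function M L Y \<and>
     (AE \<omega> in M. \<forall>t\<ge>0. Y t \<omega> \<ge> 0) \<and>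
     (AE \<omega> in M. \<forall>t\<ge>0. (\<lambda>s. Y s \<omega>) integrable_on {0..t} \<and>
        Y t \<omega> = y0 - b * integral {0..t} (\<lambda>s. Y s \<omega>) + \<sigma> * B t \<omega> + L t \<omega>)"

end

theory Submission
  imports Defs
begin

text \<open>
  The argument is pathwise: on the almost sure event where the driving path is continuous and all
  the equations are solved, the monotonicity of the drift decides everything. For two solutions
  \<open>u, v\<close> with parameters \<open>\<epsilon>1 \<le> \<epsilon>2\<close> and the same driving path, the noise
  cancels in \<open>v - u\<close>, which is therefore continuously differentiable, and
  \[ \frac{d}{dt} (v - u)^2 = (v - u) \Bigl(\frac{\varepsilon_2}{v} - \frac{\varepsilon_1}{u}
       - b (v - u)\Bigr) \le \varepsilon_2 - \varepsilon_1, \]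
  because \<open>x \<mapsto> \<epsilon>1 / x\<close> is decreasing and \<open>(v - u) / v \<le> 1\<close>. Hence
  \<open>\<bar>v t - u t\<bar> \<le> sqrt ((\<epsilon>2 - \<epsilon>1) * t)\<close>
  (\<open>solution_energy_estimate\<close>). This single inequality yields existence of the limit, and
  the rate \<open>sqrt (\<epsilon> * T)\<close> of uniform convergence on \<open>[0, T]\<close>.

  The singular drift \<open>1/2 * \<integral> \<epsilon> / y\<close> is, by the equation, an affine expression in
  \<open>y\<close>, its integral and the driving path. It therefore converges at the same rate
  (\<open>limit_push_dist_uniform\<close>); its limit inherits monotonicity. Where the limit of
  \<open>y\<close> stays above some \<open>c > 0\<close>, the singular drift has, for small \<open>\<epsilon>\<close>, density at most
  \<open>\<epsilon> / c\<close>, which vanishes, so that its limit can only grow at zeros of the limit path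
  (\<open>limit_push_growth\<close>).

  Two probabilistic points remain. The limit processes must be random variables on a space that
  need not be complete: they are defined as limits of sequences of random variables, the integral
  of the limit process being a limit of Riemann sums. And the Gaussian structure has to be carried
  from a fractional Brownian motion to its modification
  (\<open>fractional_brownian_motion_modification\<close>).
\<close>

section \<open>Continuity, Riemann sums and suprema\<close>

lemma continuous_on_halfline:
  fixes f :: "real \<Rightarrow> real"
  assumes "\<And>T. T \<ge> 0 \<Longrightarrow> continuous_on {0..T} f"
  shows "continuous_on {0..} f"
proof -
  have "continuous (at x within {0..}) f" if "x \<ge> 0" for x
  proof -
    have "at x within {0..} = at x within {0..x+1}"
      by (rule at_within_nhd[of x "{..<x+1}"]) auto
    moreover have "continuous (at x within {0..x+1}) f"
      using assms[of "x+1"] that by (auto simp: continuous_on_eq_continuous_within)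
    ultimately show ?thesis by simp
  qed
  then show ?thesis by (auto simp: continuous_on_eq_continuous_within)
qed

lemma left_Riemann_sum_error:
  fixes f :: "real \<Rightarrow> real"
  assumes "h \<ge> 0" and "continuous_on {0..real n * h} f"
    and osc: "\<And>x y. x \<in> {0..real n * h} \<Longrightarrow> y \<in> {0..real n * h} \<Longrightarrow> \<bar>x - y\<bar> \<le> h \<Longrightarrow> \<bar>f x - f y\<bar> \<le> e"
  shows "\<bar>integral {0..real n * h} f - h * (\<Sum>k<n. f (real k * h))\<bar> \<le> real n * h * e"
  using assms(2,3)
proof (induction n)
  case 0
  then show ?case by simp
next
  case (Suc n)
  let ?a = "real n * h" and ?c = "real (Suc n) * h"
  have le: "0 \<le> ?a" "?a \<le> ?c" and len: "?c - ?a = h"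
    using \<open>h \<ge> 0\<close> by (auto simp: algebra_simps)
  have "continuous_on {0..?a} f"
    using Suc.prems(1) le by (auto intro: continuous_on_subset)
  then have IH: "\<bar>integral {0..?a} f - h * (\<Sum>k<n. f (real k * h))\<bar> \<le> ?a * e"
    using Suc.prems(2) le by (intro Suc.IH) auto
  have int: "f integrable_on {0..?c}"
    using Suc.prems(1) by (rule integrable_continuous_real)
  have int': "f integrable_on {?a..?c}"
    using le by (intro integrable_on_subinterval[OF int]) auto
  have split: "integral {0..?c} f = integral {0..?a} f + integral {?a..?c} f"
    using Henstock_Kurzweil_Integration.integral_combine[OF le int] by simp
  have "integral {?a..?c} f - h * f ?a = integral {?a..?c} (\<lambda>x. f x - f ?a)"
    using int' len le by (subst integral_diff) auto
  also have "norm \<dots> \<le> e * (?c - ?a)"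
  proof (rule integral_bound)
    show "continuous_on {?a..?c} (\<lambda>x. f x - f ?a)"
      using Suc.prems(1) le by (intro continuous_intros continuous_on_subset[OF Suc.prems(1)]) auto
    show "norm (f x - f ?a) \<le> e" if "x \<in> {?a..?c}" for x
    proof -
      have "0 \<le> x" "\<bar>x - ?a\<bar> \<le> h"
        using that le len unfolding atLeastAtMost_iff by linarith+
      then show ?thesis using Suc.prems(2)[of x ?a] that le by auto
    qed
  qed (use le in auto)
  finally have "\<bar>integral {?a..?c} f - h * f ?a\<bar> \<le> h * e"
    unfolding len by (simp only: real_norm_def mult.commute)
  with IH split show ?case by (auto simp: algebra_simps abs_le_iff)
qed

text \<open>
  Riemann sums present the integral of a process over time as a limit of random variables; this
  gives its measurability in the sample point without joint measurability of the process.
\<close>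

lemma left_Riemann_sums_tendsto_integral:
  fixes f :: "real \<Rightarrow> real"
  assumes "t \<ge> 0" and cont: "continuous_on {0..t} f"
  shows "(\<lambda>n. t / real (Suc n) * (\<Sum>k<Suc n. f (real k * (t / real (Suc n)))))
           \<longlonglongrightarrow> integral {0..t} f"
proof (rule LIMSEQ_I)
  fix r :: real assume "r > 0"
  define e where "e = r / (t + 1)"
  have e: "e > 0" using \<open>r > 0\<close> \<open>t \<ge> 0\<close> by (simp add: e_def)
  have "uniformly_continuous_on {0..t} f"
    using cont by (rule compact_uniformly_continuous) simp
  then obtain d where d: "d > 0"
    and osc: "\<And>x y. x \<in> {0..t} \<Longrightarrow> y \<in> {0..t} \<Longrightarrow> \<bar>x - y\<bar> < d \<Longrightarrow> \<bar>f x - f y\<bar> < e"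
    using e unfolding uniformly_continuous_on_def dist_real_def by metis
  obtain N where N: "real N > t / d" using reals_Archimedean2 by blast
  have "norm (t / real (Suc n) * (\<Sum>k<Suc n. f (real k * (t / real (Suc n)))) - integral {0..t} f) < r"
    if "n \<ge> N" for n
  proof -
    let ?h = "t / real (Suc n)"
    have nh: "real (Suc n) * ?h = t" by simp
    have "t / d < real (Suc n)" using N that by linarith
    then have h: "?h < d" using d by (simp add: field_simps)
    have "\<bar>integral {0..real (Suc n) * ?h} f - ?h * (\<Sum>k<Suc n. f (real k * ?h))\<bar> \<le> real (Suc n) * ?h * e"
    proof (rule left_Riemann_sum_error)
      show "0 \<le> ?h" using \<open>t \<ge> 0\<close> by simp
      show "continuous_on {0..real (Suc n) * ?h} f" unfolding nh by (rule cont)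
      show "\<bar>f x - f y\<bar> \<le> e" if "x \<in> {0..real (Suc n) * ?h}" "y \<in> {0..real (Suc n) * ?h}"
          "\<bar>x - y\<bar> \<le> ?h" for x y
        using osc[of x y] that h unfolding nh by auto
    qed
    also have "real (Suc n) * ?h * e < r"
      unfolding nh e_def using \<open>t \<ge> 0\<close> \<open>r > 0\<close> by (simp add: field_simps)
    finally show ?thesis unfolding nh by (simp add: abs_minus_commute)
  qed
  then show "\<exists>N. \<forall>n\<ge>N. norm (t / real (Suc n) * (\<Sum>k<Suc n. f (real k * (t / real (Suc n)))) - integral {0..t} f) < r"
    by blast
qed

lemma SUP_abs_tendsto_0:
  fixes f :: "real \<Rightarrow> 'b \<Rightarrow> real" and g :: "real \<Rightarrow> real"
  assumes bound: "\<And>\<epsilon> t. \<epsilon> > 0 \<Longrightarrow> t \<in> S \<Longrightarrow> \<bar>f \<epsilon> t\<bar> \<le> g \<epsilon>" and "S \<noteq> {}"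
    and g: "(g \<longlongrightarrow> 0) (at_right 0)"
  shows "((\<lambda>\<epsilon>. SUP t\<in>S. \<bar>f \<epsilon> t\<bar>) \<longlongrightarrow> 0) (at_right 0)"
proof (rule Lim_null_comparison[OF _ g])
  show "\<forall>\<^sub>F \<epsilon> in at_right 0. norm (SUP t\<in>S. \<bar>f \<epsilon> t\<bar>) \<le> g \<epsilon>"
    using eventually_at_right_less[of "0::real"]
  proof eventually_elim
    case (elim \<epsilon>)
    obtain a where "a \<in> S" using \<open>S \<noteq> {}\<close> by blast
    have "0 \<le> (SUP t\<in>S. \<bar>f \<epsilon> t\<bar>)"
      using bound[OF elim] by (intro cSUP_upper2[OF _ \<open>a \<in> S\<close>] bdd_aboveI2[where M = "g \<epsilon>"]) auto
    moreover have "(SUP t\<in>S. \<bar>f \<epsilon> t\<bar>) \<le> g \<epsilon>"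
      using bound[OF elim] \<open>S \<noteq> {}\<close> by (intro cSUP_least) auto
    ultimately show ?case by simp
  qed
qed

section \<open>The square root equation along a single path\<close>

text \<open>
  One sample point: a fixed driving path, and for every \<open>\<epsilon>\<close> a solution \<open>y \<epsilon>\<close>.
\<close>

locale sqrt_equation_family =
  fixes y0 b \<sigma> :: real and \<beta> :: "real \<Rightarrow> real" and y :: "real \<Rightarrow> real \<Rightarrow> real"
  assumes b_nonneg: "b \<ge> 0"
    and cont_driver: "continuous_on {0..} \<beta>"
    and solution: "\<And>\<epsilon>. \<epsilon> > 0 \<Longrightarrow> sqrt_equation_solution y0 b \<sigma> \<epsilon> \<beta> (y \<epsilon>)"
begin

lemma
  assumes "\<epsilon> > 0" "t \<ge> 0"
  shows solution_pos: "y \<epsilon> t > 0"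
    and drift_integrable: "(\<lambda>s. \<epsilon> / y \<epsilon> s - b * y \<epsilon> s) integrable_on {0..t}"
    and solution_eq: "y \<epsilon> t = y0 + 1/2 * integral {0..t} (\<lambda>s. \<epsilon> / y \<epsilon> s - b * y \<epsilon> s) + \<sigma> / 2 * \<beta> t"
  using solution[OF assms(1)] assms(2) unfolding sqrt_equation_solution_def by auto

lemma continuous_on_solution:
  assumes "\<epsilon> > 0"
  shows "continuous_on {0..T} (y \<epsilon>)"
proof (cases "T \<ge> 0")
  case True
  have "continuous_on {0..T}
      (\<lambda>t. y0 + 1/2 * integral {0..t} (\<lambda>s. \<epsilon> / y \<epsilon> s - b * y \<epsilon> s) + \<sigma> / 2 * \<beta> t)"
    by (intro continuous_intros indefinite_integral_continuous_1 drift_integrable assms True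
        continuous_on_subset[OF cont_driver]) auto
  then show ?thesis
    by (rule continuous_on_eq) (metis atLeastAtMost_iff assms solution_eq)
qed simp

lemma continuous_on_inverse_solution:
  assumes "\<epsilon> > 0"
  shows "continuous_on {0..T} (\<lambda>s. \<epsilon> / y \<epsilon> s)"
  using solution_pos[OF assms]
  by (intro continuous_intros continuous_on_solution assms) force

text \<open>
  The effect of the singular term, which pushes the solution away from zero. It approximates the
  reflection function.
\<close>

definition push :: "real \<Rightarrow> real \<Rightarrow> real" where
  "push \<epsilon> t = 1/2 * integral {0..t} (\<lambda>s. \<epsilon> / y \<epsilon> s)"

lemma solution_eq_push:
  assumes "\<epsilon> > 0" "t \<ge> 0"
  shows "y \<epsilon> t = y0 - b / 2 * integral {0..t} (y \<epsilon>) + \<sigma> / 2 * \<beta> t + push \<epsilon> t"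
proof -
  have "integral {0..t} (\<lambda>s. \<epsilon> / y \<epsilon> s - b * y \<epsilon> s)
      = integral {0..t} (\<lambda>s. \<epsilon> / y \<epsilon> s) - integral {0..t} (\<lambda>s. b * y \<epsilon> s)"
    by (intro integral_diff integrable_continuous_real continuous_on_inverse_solution
        continuous_intros continuous_on_solution assms)
  then show ?thesis
    using solution_eq[OF assms] by (simp add: push_def algebra_simps)
qed

text \<open>
  The derivative of the squared difference is at most \<open>\<epsilon>2 - \<epsilon>1\<close>: the linear drift
  and the change of \<open>\<epsilon>1 / x\<close> between the two solutions both draw them together, and
  the surplus \<open>(\<epsilon>2 - \<epsilon>1) / y \<epsilon>2\<close> is tamed by the factor
  \<open>y \<epsilon>2 - y \<epsilon>1 \<le> y \<epsilon>2\<close>.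
\<close>

lemma solution_energy_estimate:
  assumes "0 < \<epsilon>1" "\<epsilon>1 \<le> \<epsilon>2" "t \<ge> 0"
  shows "(y \<epsilon>2 t - y \<epsilon>1 t)\<^sup>2 \<le> (\<epsilon>2 - \<epsilon>1) * t"
proof -
  have pos: "0 < \<epsilon>1" "0 < \<epsilon>2" using assms by auto
  define g where "g s = (\<epsilon>2 / y \<epsilon>2 s - b * y \<epsilon>2 s) - (\<epsilon>1 / y \<epsilon>1 s - b * y \<epsilon>1 s)" for s
  define d where "d s = y \<epsilon>2 s - y \<epsilon>1 s" for s
  have cont_g: "continuous_on {0..t} g"
    unfolding g_def
    by (intro continuous_intros continuous_on_inverse_solution continuous_on_solution pos)
  have d_eq: "d s = 1/2 * integral {0..s} g" if "s \<ge> 0" for s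
    using that unfolding d_def g_def
    by (subst integral_diff)
      (auto simp: solution_eq[OF pos(1)] solution_eq[OF pos(2)] algebra_simps
        intro!: drift_integrable pos)
  have d_deriv: "(d has_real_derivative g s / 2) (at s within {0..t})" if "s \<in> {0..t}" for s
  proof -
    have "((\<lambda>u. integral {0..u} g) has_real_derivative g s) (at s within {0..t})"
      using cont_g that by (rule integral_has_real_derivative)
    then have "((\<lambda>u. 1/2 * integral {0..u} g) has_real_derivative g s / 2) (at s within {0..t})"
      by (auto intro!: derivative_eq_intros)
    then show ?thesis
      by (rule has_field_derivative_transform_within[OF _ zero_less_one that]) (auto simp: d_eq)
  qed
  \<comment> \<open>Twice the derivative of \<open>d\<close> is \<open>g\<close>, so that \<open>d * g\<close> is the derivative of the square of \<open>d\<close>.\<close>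
  have dg: "d s * g s \<le> \<epsilon>2 - \<epsilon>1" if "s \<ge> 0" for s
  proof -
    define u v where "u = y \<epsilon>1 s" and "v = y \<epsilon>2 s"
    have uv: "u > 0" "v > 0" unfolding u_def v_def using solution_pos pos that by auto
    have "d s * g s = (\<epsilon>2 - \<epsilon>1) * ((v - u) / v) - \<epsilon>1 * (v - u)\<^sup>2 / (u * v) - b * (v - u)\<^sup>2"
      unfolding d_def g_def u_def[symmetric] v_def[symmetric] using uv
      by (simp add: field_simps power2_eq_square)
    also have "\<dots> \<le> (\<epsilon>2 - \<epsilon>1) * ((v - u) / v)"
    proof -
      have "\<epsilon>1 * (v - u)\<^sup>2 / (u * v) \<ge> 0" "b * (v - u)\<^sup>2 \<ge> 0"
        using uv pos b_nonneg by auto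
      then show ?thesis by linarith
    qed
    also have "\<dots> \<le> (\<epsilon>2 - \<epsilon>1) * 1"
      using uv assms by (intro mult_left_mono) (auto simp: field_simps)
    finally show ?thesis by simp
  qed
  define e where "e s = (d s)\<^sup>2 - (\<epsilon>2 - \<epsilon>1) * s" for s
  have "e t \<le> e 0"
  proof (rule DERIV_nonpos_imp_decreasing_open[OF \<open>t \<ge> 0\<close>])
    have e_deriv: "(e has_real_derivative (d s * g s - (\<epsilon>2 - \<epsilon>1))) (at s within {0..t})"
      if "s \<in> {0..t}" for s
      unfolding e_def using d_deriv[OF that] by (auto intro!: derivative_eq_intros)
    show "continuous_on {0..t} e"
      using e_deriv by (intro DERIV_continuous_on) auto
    show "\<exists>z. (e has_real_derivative z) (at s) \<and> z \<le> 0" if "0 < s" "s < t" for s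
      using e_deriv[of s] dg[of s] that by (auto simp: at_within_Icc_at)
  qed
  moreover have "d 0 = 0" using d_eq[of 0] by simp
  ultimately show ?thesis by (simp add: e_def d_def)
qed

lemma solution_dist:
  assumes "0 < \<epsilon>1" "0 < \<epsilon>2" "t \<ge> 0"
  shows "\<bar>y \<epsilon>2 t - y \<epsilon>1 t\<bar> \<le> sqrt (\<bar>\<epsilon>2 - \<epsilon>1\<bar> * t)"
proof (rule real_le_rsqrt)
  show "\<bar>y \<epsilon>2 t - y \<epsilon>1 t\<bar>\<^sup>2 \<le> \<bar>\<epsilon>2 - \<epsilon>1\<bar> * t"
    using solution_energy_estimate[of \<epsilon>1 \<epsilon>2 t] solution_energy_estimate[of \<epsilon>2 \<epsilon>1 t] assms
    by (cases "\<epsilon>1 \<le> \<epsilon>2") (auto simp: power2_commute)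
qed

text \<open>
  The limit is taken along a sequence, since a limit along the uncountable family of all
  \<open>\<epsilon>\<close> would not be visibly measurable in the sample point.
\<close>

definition limit_path :: "real \<Rightarrow> real" where
  "limit_path t = lim (\<lambda>n. y (inverse (real (Suc n))) t)"

lemma limit_path_tendsto_seq:
  assumes "t \<ge> 0"
  shows "(\<lambda>n. y (inverse (real (Suc n))) t) \<longlonglongrightarrow> limit_path t"
proof -
  define a where "a n = inverse (real (Suc n))" for n
  have a_pos: "a n > 0" for n by (simp add: a_def)
  have "Cauchy (\<lambda>n. y (a n) t)"
  proof (rule metric_CauchyI)
    fix e :: real assume "e > 0"
    have "(\<lambda>n. sqrt (a n * t)) \<longlonglongrightarrow> sqrt (0 * t)"
      unfolding a_def by (intro tendsto_intros LIMSEQ_inverse_real_of_nat)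
    then have "\<forall>\<^sub>F n in sequentially. sqrt (a n * t) < e"
      using \<open>e > 0\<close> by (intro order_tendstoD) auto
    then obtain N where N: "sqrt (a N * t) < e"
      by (auto simp: eventually_sequentially)
    have "dist (y (a m) t) (y (a n) t) < e" if "m \<ge> N" "n \<ge> N" for m n
    proof -
      have "a m \<le> a N" "a n \<le> a N" using that by (auto simp: a_def field_simps)
      then have "\<bar>a m - a n\<bar> \<le> a N" using a_pos[of m] a_pos[of n] by linarith
      then have "sqrt (\<bar>a m - a n\<bar> * t) \<le> sqrt (a N * t)"
        using assms by (intro real_sqrt_le_mono mult_right_mono) auto
      then show ?thesis
        using solution_dist[OF a_pos a_pos assms, of m n] N unfolding dist_real_def by linarith
    qed
    then show "\<exists>N. \<forall>m\<ge>N. \<forall>n\<ge>N. dist (y (a m) t) (y (a n) t) < e" by blast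
  qed
  then show ?thesis
    unfolding limit_path_def a_def by (intro convergent_LIMSEQ_iff[THEN iffD1] Cauchy_convergent)
qed

text \<open>Let the other parameter in \<open>solution_dist\<close> tend to zero.\<close>

lemma limit_path_dist:
  assumes "\<epsilon> > 0" "t \<ge> 0"
  shows "\<bar>limit_path t - y \<epsilon> t\<bar> \<le> sqrt (\<epsilon> * t)"
proof (rule LIMSEQ_le)
  show "(\<lambda>n. \<bar>y (inverse (real (Suc n))) t - y \<epsilon> t\<bar>) \<longlonglongrightarrow> \<bar>limit_path t - y \<epsilon> t\<bar>"
    by (intro tendsto_intros limit_path_tendsto_seq assms)
  have "(\<lambda>n. sqrt (\<bar>inverse (real (Suc n)) - \<epsilon>\<bar> * t)) \<longlonglongrightarrow> sqrt (\<bar>0 - \<epsilon>\<bar> * t)"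
    by (intro tendsto_intros LIMSEQ_inverse_real_of_nat)
  then show "(\<lambda>n. sqrt (\<bar>inverse (real (Suc n)) - \<epsilon>\<bar> * t)) \<longlonglongrightarrow> sqrt (\<epsilon> * t)"
    using assms by simp
  show "\<exists>N. \<forall>n\<ge>N. \<bar>y (inverse (real (Suc n))) t - y \<epsilon> t\<bar> \<le> sqrt (\<bar>inverse (real (Suc n)) - \<epsilon>\<bar> * t)"
    using assms by (auto intro!: solution_dist)
qed

lemma limit_path_dist_uniform:
  assumes "\<epsilon> > 0" "t \<in> {0..T}"
  shows "\<bar>limit_path t - y \<epsilon> t\<bar> \<le> sqrt (\<epsilon> * T)"
proof -
  have "sqrt (\<epsilon> * t) \<le> sqrt (\<epsilon> * T)"
    using assms by (intro real_sqrt_le_mono mult_left_mono) auto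
  moreover have "\<bar>limit_path t - y \<epsilon> t\<bar> \<le> sqrt (\<epsilon> * t)"
    using assms by (intro limit_path_dist) auto
  ultimately show ?thesis by linarith
qed

lemma sqrt_bound_tendsto_0: "((\<lambda>\<epsilon>. sqrt (\<epsilon> * T) * C) \<longlongrightarrow> 0) (at_right 0)"
proof -
  have "((\<lambda>\<epsilon>. sqrt (\<epsilon> * T) * C) \<longlongrightarrow> sqrt (0 * T) * C) (at_right 0)"
    by (intro tendsto_intros)
  then show ?thesis by simp
qed

lemma uniform_limit_limit_path: "uniform_limit {0..T} y limit_path (at_right 0)"
proof (rule uniform_limitI)
  fix e :: real assume "e > 0"
  then have "\<forall>\<^sub>F \<epsilon> in at_right 0. sqrt (\<epsilon> * T) * 1 < e"
    using sqrt_bound_tendsto_0 by (rule order_tendstoD(2)[rotated])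
  moreover have "\<forall>\<^sub>F \<epsilon> in at_right (0::real). \<epsilon> > 0" by (rule eventually_at_right_less)
  ultimately show "\<forall>\<^sub>F \<epsilon> in at_right 0. \<forall>t\<in>{0..T}. dist (y \<epsilon> t) (limit_path t) < e"
  proof eventually_elim
    case (elim \<epsilon>)
    then show ?case
      using limit_path_dist_uniform[of \<epsilon> _ T] by (force simp: dist_real_def abs_minus_commute)
  qed
qed

lemma limit_path_tendsto:
  assumes "t \<ge> 0"
  shows "((\<lambda>\<epsilon>. y \<epsilon> t) \<longlongrightarrow> limit_path t) (at_right 0)"
  by (rule tendsto_uniform_limitI[OF uniform_limit_limit_path[of t]]) (use assms in auto)

lemma limit_path_nonneg:
  assumes "t \<ge> 0"
  shows "limit_path t \<ge> 0"
proof (rule LIMSEQ_le_const[OF limit_path_tendsto_seq[OF assms]])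
  show "\<exists>N. \<forall>n\<ge>N. 0 \<le> y (inverse (real (Suc n))) t"
    using assms by (auto intro!: less_imp_le solution_pos)
qed

lemma continuous_on_limit_path: "continuous_on {0..T} limit_path"
proof (rule uniform_limit_theorem[OF _ uniform_limit_limit_path])
  show "\<forall>\<^sub>F \<epsilon> in at_right 0. continuous_on {0..T} (y \<epsilon>)"
    using eventually_at_right_less[of "0::real"]
    by eventually_elim (rule continuous_on_solution)
qed simp

text \<open>
  The equation \<open>solution_eq_push\<close>, solved for the push and read for the limit path.
\<close>

definition limit_push :: "real \<Rightarrow> real" where
  "limit_push t = limit_path t - y0 + b / 2 * integral {0..t} limit_path - \<sigma> / 2 * \<beta> t"

lemma limit_push_dist_uniform:
  assumes "\<epsilon> > 0" "t \<in> {0..T}"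
  shows "\<bar>limit_push t - push \<epsilon> t\<bar> \<le> sqrt (\<epsilon> * T) * (1 + b / 2 * T)"
proof -
  have t: "t \<ge> 0" "t \<le> T" "T \<ge> 0" using assms by auto
  have "integral {0..t} limit_path - integral {0..t} (y \<epsilon>)
      = integral {0..t} (\<lambda>s. limit_path s - y \<epsilon> s)"
    by (intro integral_diff[symmetric] integrable_continuous_real continuous_on_limit_path
        continuous_on_solution assms)
  also have "norm \<dots> \<le> sqrt (\<epsilon> * T) * (t - 0)"
    using t assms
    by (intro integral_bound continuous_intros continuous_on_limit_path continuous_on_solution)
      (auto intro!: limit_path_dist_uniform)
  also have "\<dots> \<le> sqrt (\<epsilon> * T) * T"
    using t assms by (intro mult_left_mono) auto
  finally have I: "\<bar>integral {0..t} limit_path - integral {0..t} (y \<epsilon>)\<bar> \<le> sqrt (\<epsilon> * T) * T"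
    by simp
  have "limit_push t - push \<epsilon> t
      = (limit_path t - y \<epsilon> t) + b / 2 * (integral {0..t} limit_path - integral {0..t} (y \<epsilon>))"
    using solution_eq_push[OF assms(1) t(1)] by (simp add: limit_push_def algebra_simps)
  also have "\<bar>\<dots>\<bar> \<le> \<bar>limit_path t - y \<epsilon> t\<bar>
      + b / 2 * \<bar>integral {0..t} limit_path - integral {0..t} (y \<epsilon>)\<bar>"
    using b_nonneg by (intro order_trans[OF abs_triangle_ineq]) (simp add: abs_mult)
  also have "\<dots> \<le> sqrt (\<epsilon> * T) + b / 2 * (sqrt (\<epsilon> * T) * T)"
    using b_nonneg I limit_path_dist_uniform[OF assms] by (intro add_mono mult_left_mono) auto
  finally show ?thesis by (simp add: algebra_simps)
qed

lemma push_tendsto: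
  assumes "t \<ge> 0"
  shows "((\<lambda>\<epsilon>. push \<epsilon> t) \<longlongrightarrow> limit_push t) (at_right 0)"
proof (rule LIM_zero_cancel, rule Lim_null_comparison[OF _ sqrt_bound_tendsto_0])
  show "\<forall>\<^sub>F \<epsilon> in at_right 0. norm (push \<epsilon> t - limit_push t) \<le> sqrt (\<epsilon> * t) * (1 + b / 2 * t)"
    using eventually_at_right_less[of "0::real"]
    by eventually_elim
      (use limit_push_dist_uniform[of _ t t] assms in \<open>auto simp: abs_minus_commute\<close>)
qed

lemma push_increment:
  assumes "\<epsilon> > 0" "0 \<le> s" "s \<le> t"
  shows "push \<epsilon> t - push \<epsilon> s = 1/2 * integral {s..t} (\<lambda>u. \<epsilon> / y \<epsilon> u)"
proof -
  have "(\<lambda>u. \<epsilon> / y \<epsilon> u) integrable_on {0..t}"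
    by (intro integrable_continuous_real continuous_on_inverse_solution assms)
  from Henstock_Kurzweil_Integration.integral_combine[OF assms(2,3) this]
  show ?thesis by (simp add: push_def algebra_simps)
qed

lemma limit_push_mono:
  assumes "0 \<le> s" "s \<le> t"
  shows "limit_push s \<le> limit_push t"
proof (rule tendsto_le[OF _ push_tendsto push_tendsto])
  show "\<forall>\<^sub>F \<epsilon> in at_right 0. push \<epsilon> s \<le> push \<epsilon> t"
    using eventually_at_right_less[of "0::real"]
  proof eventually_elim
    case (elim \<epsilon>)
    have "0 \<le> integral {s..t} (\<lambda>u. \<epsilon> / y \<epsilon> u)"
    proof (rule Henstock_Kurzweil_Integration.integral_nonneg)
      show "(\<lambda>u. \<epsilon> / y \<epsilon> u) integrable_on {s..t}"
        using assms
        by (intro integrable_continuous_real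
            continuous_on_subset[OF continuous_on_inverse_solution[OF elim, of t]]) auto
      show "0 \<le> \<epsilon> / y \<epsilon> u" if "u \<in> {s..t}" for u
        using solution_pos[OF elim, of u] elim that assms by simp
    qed
    then show ?case using push_increment[OF elim assms] by simp
  qed
qed (use assms in auto)

lemma limit_push_0: "limit_push 0 = 0"
proof (rule tendsto_unique[OF _ push_tendsto])
  show "((\<lambda>\<epsilon>. push \<epsilon> 0) \<longlongrightarrow> 0) (at_right 0)" by (simp add: push_def)
qed auto

lemma continuous_on_limit_push: "continuous_on {0..} limit_push"
proof (rule continuous_on_halfline)
  fix T :: real assume "T \<ge> 0"
  show "continuous_on {0..T} limit_push"
    unfolding limit_push_def
    by (intro continuous_intros continuous_on_limit_path indefinite_integral_continuous_1
        integrable_continuous_real continuous_on_subset[OF cont_driver]) auto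
qed

text \<open>
  For small \<open>\<epsilon>\<close> the solutions exceed \<open>c / 2\<close> on the interval, so that the push
  over it is at most \<open>\<epsilon> * (t - s) / c\<close>.
\<close>

lemma limit_push_constant:
  assumes "0 \<le> s" "s \<le> t" "c > 0"
    and away: "\<And>u. u \<in> {s..t} \<Longrightarrow> limit_path u \<ge> c"
  shows "limit_push s = limit_push t"
proof -
  have "((\<lambda>\<epsilon>. push \<epsilon> t - push \<epsilon> s) \<longlongrightarrow> 0) (at_right 0)"
  proof (rule Lim_null_comparison)
    have "\<forall>\<^sub>F \<epsilon> in at_right 0. \<forall>u\<in>{0..t}. dist (y \<epsilon> u) (limit_path u) < c / 2"
      using \<open>c > 0\<close> by (intro uniform_limitD[OF uniform_limit_limit_path]) simp
    then show "\<forall>\<^sub>F \<epsilon> in at_right 0. norm (push \<epsilon> t - push \<epsilon> s) \<le> \<epsilon> * ((t - s) / c)"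
      using eventually_at_right_less[of "0::real"]
    proof eventually_elim
      case (elim \<epsilon>)
      have lower: "y \<epsilon> u \<ge> c / 2" if "u \<in> {s..t}" for u
      proof -
        have "dist (y \<epsilon> u) (limit_path u) < c / 2" using elim(1) that assms by auto
        then show ?thesis using away[OF that] unfolding dist_real_def by linarith
      qed
      have "norm (integral {s..t} (\<lambda>u. \<epsilon> / y \<epsilon> u)) \<le> (\<epsilon> / (c / 2)) * (t - s)"
      proof (rule integral_bound)
        show "continuous_on {s..t} (\<lambda>u. \<epsilon> / y \<epsilon> u)"
          using assms by (intro continuous_on_subset[OF continuous_on_inverse_solution[OF elim(2), of t]]) auto
        show "norm (\<epsilon> / y \<epsilon> u) \<le> \<epsilon> / (c / 2)" if "u \<in> {s..t}" for u
        proof -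
          have "\<epsilon> / y \<epsilon> u \<le> \<epsilon> / (c / 2)"
            using lower[OF that] elim(2) \<open>c > 0\<close> by (intro divide_left_mono) auto
          moreover have "0 \<le> \<epsilon> / y \<epsilon> u"
            using lower[OF that] elim(2) \<open>c > 0\<close> by (intro divide_nonneg_nonneg) auto
          ultimately show ?thesis by simp
        qed
      qed (use assms in auto)
      also have "\<dots> = 2 * (\<epsilon> * ((t - s) / c))" by simp
      finally show ?case
        unfolding push_increment[OF elim(2) assms(1,2)] real_norm_def abs_mult by (simp add: mult_ac)
    qed
    have "((\<lambda>\<epsilon>. \<epsilon> * ((t - s) / c)) \<longlongrightarrow> 0 * ((t - s) / c)) (at_right 0)"
      by (intro tendsto_intros)
    then show "((\<lambda>\<epsilon>. \<epsilon> * ((t - s) / c)) \<longlongrightarrow> 0) (at_right 0)" by simp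
  qed
  moreover have "((\<lambda>\<epsilon>. push \<epsilon> t - push \<epsilon> s) \<longlongrightarrow> limit_push t - limit_push s) (at_right 0)"
    using assms by (intro tendsto_intros push_tendsto) auto
  ultimately have "limit_push t - limit_push s = 0"
    by (rule tendsto_unique[OF trivial_limit_at_right_real, rotated])
  then show ?thesis by simp
qed

lemma limit_push_growth:
  assumes "point_of_growth limit_push t"
  shows "limit_path t = 0"
proof (rule ccontr)
  assume neq: "limit_path t \<noteq> 0"
  have t: "t \<ge> 0" and growth: "\<And>\<delta>. \<delta> > 0 \<Longrightarrow> limit_push (max 0 (t - \<delta>)) < limit_push (t + \<delta>)"
    using assms by (auto simp: point_of_growth_def)
  define c where "c = limit_path t / 2"
  have c: "c > 0" using limit_path_nonneg[OF t] neq by (simp add: c_def)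
  have "t \<in> {0..t + 1}" using t by auto
  then obtain d where d: "d > 0"
    and near: "\<And>u. u \<in> {0..t + 1} \<Longrightarrow> dist u t < d \<Longrightarrow> dist (limit_path u) (limit_path t) < c"
    using continuous_on_limit_path[of "t + 1"] c unfolding continuous_on_iff by metis
  define \<delta> where "\<delta> = min 1 (d / 2)"
  have \<delta>: "\<delta> > 0" "\<delta> \<le> 1" "\<delta> < d" using d by (auto simp: \<delta>_def)
  have "limit_push (max 0 (t - \<delta>)) = limit_push (t + \<delta>)"
  proof (rule limit_push_constant[OF _ _ c])
    show "c \<le> limit_path u" if "u \<in> {max 0 (t - \<delta>)..t + \<delta>}" for u
    proof -
      have "u \<in> {0..t + 1}" "dist u t < d"
        using that \<delta> by (auto simp: dist_real_def abs_less_iff)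
      from near[OF this] have "\<bar>limit_path u - limit_path t\<bar> < c" by (simp add: dist_real_def)
      then show ?thesis unfolding c_def by linarith
    qed
  qed (use t \<delta> in auto)
  with growth[OF \<delta>(1)] show False by simp
qed

end

section \<open>Modifications of fractional Brownian motion\<close>

lemma gaussian_rv_cong_AE:
  assumes X: "gaussian_rv M X" and Z: "Z \<in> borel_measurable M" and eq: "AE \<omega> in M. Z \<omega> = X \<omega>"
  shows "gaussian_rv M Z"
proof -
  have [measurable]: "X \<in> borel_measurable M" using X by (simp add: gaussian_rv_def)
  have dist: "distr M lborel Z = distr M lborel X"
    using eq Z by (intro distr_cong_AE) auto
  consider (density) m s where "s > 0" "distributed M lborel X (normal_density m s)"
    | (point) m where "AE \<omega> in M. X \<omega> = m"
    using X by (auto simp: gaussian_rv_def)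
  then show ?thesis
  proof cases
    case density
    then have "distributed M lborel Z (normal_density m s)"
      using Z dist by (simp add: distributed_def)
    with density Z show ?thesis by (auto simp: gaussian_rv_def)
  next
    case point
    with eq have "AE \<omega> in M. Z \<omega> = m" by eventually_elim simp
    with Z show ?thesis by (auto simp: gaussian_rv_def)
  qed
qed

text \<open>
  A continuous modification agrees almost surely with the original process at each finite set of
  times, which is all that the definition of fractional Brownian motion sees.
\<close>

lemma fractional_brownian_motion_modification:
  assumes W: "fractional_brownian_motion M H W" and B: "continuous_modification M W B"
  shows "fractional_brownian_motion M H B"
proof -
  have meas: "B t \<in> borel_measurable M" "W t \<in> borel_measurable M" if "t \<ge> 0" for t
    using W B that
    by (auto simp: continuous_modification_def fractional_brownian_motion_def
        gaussian_process_def stochastic_process_def)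
  have eq: "AE \<omega> in M. B t \<omega> = W t \<omega>" if "t \<ge> 0" for t
    using B that by (simp add: continuous_modification_def)
  have "gaussian_rv M (\<lambda>\<omega>. \<Sum>t\<in>F. c t * B t \<omega>)" if F: "finite F" "F \<subseteq> {0..}" for F c
  proof (rule gaussian_rv_cong_AE)
    show "gaussian_rv M (\<lambda>\<omega>. \<Sum>t\<in>F. c t * W t \<omega>)"
      using W F by (simp add: fractional_brownian_motion_def gaussian_process_def)
    show "(\<lambda>\<omega>. \<Sum>t\<in>F. c t * B t \<omega>) \<in> borel_measurable M"
      using F by (intro borel_measurable_sum borel_measurable_times meas) auto
    have "AE \<omega> in M. \<forall>t\<in>F. B t \<omega> = W t \<omega>"
      using F eq by (intro AE_finite_allI) auto
    then show "AE \<omega> in M. (\<Sum>t\<in>F. c t * B t \<omega>) = (\<Sum>t\<in>F. c t * W t \<omega>)"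
      by eventually_elim simp
  qed
  moreover have "(\<integral>\<omega>. B t \<omega> \<partial>M) = (\<integral>\<omega>. W t \<omega> \<partial>M)" if "t \<ge> 0" for t
    using that by (intro integral_cong_AE meas eq)
  moreover have "(\<integral>\<omega>. B s \<omega> * B t \<omega> \<partial>M) = (\<integral>\<omega>. W s \<omega> * W t \<omega> \<partial>M)" if "s \<ge> 0" "t \<ge> 0" for s t
  proof (rule integral_cong_AE)
    show "AE \<omega> in M. B s \<omega> * B t \<omega> = W s \<omega> * W t \<omega>"
      using eq[OF that(1)] eq[OF that(2)] by eventually_elim simp
  qed (use that in \<open>auto intro!: borel_measurable_times meas\<close>)
  ultimately show ?thesis
    using W meas
    by (simp add: fractional_brownian_motion_def gaussian_process_def stochastic_process_def)
qed

section \<open>Convergence to the reflected process\<close>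

theorem theorem3p2:
  fixes M :: "'a measure" and H y0 b \<sigma> :: real
    and W B :: "real \<Rightarrow> 'a \<Rightarrow> real"
    and Y\<epsilon> :: "real \<Rightarrow> real \<Rightarrow> 'a \<Rightarrow> real"
  assumes "prob_space M"
    and "1/2 < H" and "H < 1"
    and "y0 > 0" and "b > 0" and "\<sigma> > 0"
    and "fractional_brownian_motion M H W"
    and "continuous_modification M W B"
    and "\<And>\<epsilon>. \<epsilon> > 0 \<Longrightarrow> stochastic_process M (Y\<epsilon> \<epsilon>)"
    and "AE \<omega> in M. \<forall>\<epsilon>>0. sqrt_equation_solution y0 b \<sigma> \<epsilon> (\<lambda>t. B t \<omega>) (\<lambda>t. Y\<epsilon> \<epsilon> t \<omega>)"
  shows "\<exists>Y L.
    (AE \<omega> in M. \<forall>t\<ge>0. ((\<lambda>\<epsilon>. Y\<epsilon> \<epsilon> t \<omega>) \<longlongrightarrow> Y t \<omega>) (at_right 0) \<and> Y t \<omega> \<ge> 0) \<and>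
    RFOU_process M H B y0 (b / 2) (\<sigma> / 2) Y L \<and>
    (AE \<omega> in M. \<forall>T>0.
       ((\<lambda>\<epsilon>. SUP t\<in>{0..T}. \<bar>Y t \<omega> - Y\<epsilon> \<epsilon> t \<omega>\<bar>) \<longlongrightarrow> 0) (at_right 0) \<and>
       ((\<lambda>\<epsilon>. SUP t\<in>{0..T}. \<bar>L t \<omega> - 1/2 * integral {0..t} (\<lambda>s. \<epsilon> / Y\<epsilon> \<epsilon> s \<omega>)\<bar>) \<longlongrightarrow> 0) (at_right 0))"
proof -
  define Y where "Y t \<omega> = lim (\<lambda>n. Y\<epsilon> (inverse (real (Suc n))) t \<omega>)" for t \<omega>
  define J where "J t \<omega> = lim (\<lambda>n. t / real (Suc n) * (\<Sum>k<Suc n. Y (real k * (t / real (Suc n))) \<omega>))"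
    for t \<omega>
  define L where "L t \<omega> = Y t \<omega> - y0 + b / 2 * J t \<omega> - \<sigma> / 2 * B t \<omega>" for t \<omega>

  have B_cont: "AE \<omega> in M. continuous_on {0..} (\<lambda>t. B t \<omega>)"
    and B_meas: "\<And>t. t \<ge> 0 \<Longrightarrow> B t \<in> borel_measurable M"
    using assms(8) by (auto simp: continuous_modification_def stochastic_process_def)
  have Y_meas: "Y t \<in> borel_measurable M" if "t \<ge> 0" for t
    unfolding Y_def using assms(9) that
    by (intro borel_measurable_lim_metric) (auto simp: stochastic_process_def)
  \<comment> \<open>\<open>J\<close> is the time integral of \<open>Y\<close> for almost every sample point, and measurable everywhere.\<close>
  have J_meas: "J t \<in> borel_measurable M" if "t \<ge> 0" for t
    unfolding J_def using that
    by (intro borel_measurable_lim_metric borel_measurable_times borel_measurable_sum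
        borel_measurable_const Y_meas) auto
  have L_meas: "L t \<in> borel_measurable M" if "t \<ge> 0" for t
    unfolding L_def using Y_meas[OF that] J_meas[OF that] B_meas[OF that] by measurable

  have family_AE: "AE \<omega> in M. sqrt_equation_family y0 b \<sigma> (\<lambda>t. B t \<omega>) (\<lambda>\<epsilon> t. Y\<epsilon> \<epsilon> t \<omega>)"
    using B_cont assms(10) by eventually_elim (use assms(5) in \<open>unfold_locales, auto\<close>)
  \<comment> \<open>From here on the sample point is fixed, and the pathwise results transfer to \<open>Y\<close> and \<open>L\<close>.\<close>
  have path: "(\<forall>t\<ge>0. ((\<lambda>\<epsilon>. Y\<epsilon> \<epsilon> t \<omega>) \<longlongrightarrow> Y t \<omega>) (at_right 0) \<and> Y t \<omega> \<ge> 0) \<and>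
      (continuous_on {0..} (\<lambda>t. L t \<omega>) \<and> mono_on {0..} (\<lambda>t. L t \<omega>) \<and>
        L 0 \<omega> = 0 \<and> (\<forall>t. point_of_growth (\<lambda>u. L u \<omega>) t \<longrightarrow> Y t \<omega> = 0)) \<and>
      (\<forall>t\<ge>0. (\<lambda>s. Y s \<omega>) integrable_on {0..t} \<and>
        Y t \<omega> = y0 - b / 2 * integral {0..t} (\<lambda>s. Y s \<omega>) + \<sigma> / 2 * B t \<omega> + L t \<omega>) \<and>
      (\<forall>T>0. ((\<lambda>\<epsilon>. SUP t\<in>{0..T}. \<bar>Y t \<omega> - Y\<epsilon> \<epsilon> t \<omega>\<bar>) \<longlongrightarrow> 0) (at_right 0) \<and>
       ((\<lambda>\<epsilon>. SUP t\<in>{0..T}. \<bar>L t \<omega> - 1/2 * integral {0..t} (\<lambda>s. \<epsilon> / Y\<epsilon> \<epsilon> s \<omega>)\<bar>) \<longlongrightarrow> 0) (at_right 0))"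
    if "sqrt_equation_family y0 b \<sigma> (\<lambda>t. B t \<omega>) (\<lambda>\<epsilon> t. Y\<epsilon> \<epsilon> t \<omega>)" for \<omega>
  proof -
    interpret sqrt_equation_family y0 b \<sigma> "\<lambda>t. B t \<omega>" "\<lambda>\<epsilon> t. Y\<epsilon> \<epsilon> t \<omega>" by (rule that)
    have Y_eq: "Y t \<omega> = limit_path t" for t
      by (simp add: Y_def limit_path_def)
    have J_eq: "J t \<omega> = integral {0..t} limit_path" if "t \<ge> 0" for t
      unfolding J_def Y_eq
      by (intro limI left_Riemann_sums_tendsto_integral that continuous_on_limit_path)
    have L_eq: "L t \<omega> = limit_push t" if "t \<ge> 0" for t
      by (simp add: L_def limit_push_def Y_eq J_eq that)
    have growth: "point_of_growth (\<lambda>u. L u \<omega>) t \<longleftrightarrow> point_of_growth limit_push t" for t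
      unfolding point_of_growth_def by (auto simp: L_eq)
    have 1: "continuous_on {0..} (\<lambda>t. L t \<omega>)"
      using continuous_on_limit_push by (rule continuous_on_eq) (simp add: L_eq)
    have 2: "mono_on {0..} (\<lambda>t. L t \<omega>)"
      by (auto simp: mono_on_def L_eq intro!: limit_push_mono)
    have 3: "limit_path integrable_on {0..t}" for t
      by (intro integrable_continuous_real continuous_on_limit_path)
    have 4: "((\<lambda>\<epsilon>. SUP t\<in>{0..T}. \<bar>Y t \<omega> - Y\<epsilon> \<epsilon> t \<omega>\<bar>) \<longlongrightarrow> 0) (at_right 0)" if "T > 0" for T
      using that limit_path_dist_uniform sqrt_bound_tendsto_0[of T 1]
      by (intro SUP_abs_tendsto_0[where g = "\<lambda>\<epsilon>. sqrt (\<epsilon> * T)"]) (auto simp: Y_eq)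
    have 5: "((\<lambda>\<epsilon>. SUP t\<in>{0..T}. \<bar>L t \<omega> - 1/2 * integral {0..t} (\<lambda>s. \<epsilon> / Y\<epsilon> \<epsilon> s \<omega>)\<bar>) \<longlongrightarrow> 0) (at_right 0)"
      if "T > 0" for T
      using that limit_push_dist_uniform[unfolded push_def]
      by (intro SUP_abs_tendsto_0[OF _ _ sqrt_bound_tendsto_0[of T "1 + b / 2 * T"]])
        (auto simp: L_eq)
    have 6: "\<forall>t\<ge>0. (\<lambda>s. Y s \<omega>) integrable_on {0..t} \<and>
        Y t \<omega> = y0 - b / 2 * integral {0..t} (\<lambda>s. Y s \<omega>) + \<sigma> / 2 * B t \<omega> + L t \<omega>"
      by (simp add: Y_eq L_eq 3 limit_push_def)
    have 7: "\<forall>t\<ge>0. ((\<lambda>\<epsilon>. Y\<epsilon> \<epsilon> t \<omega>) \<longlongrightarrow> Y t \<omega>) (at_right 0) \<and> Y t \<omega> \<ge> 0"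
      using limit_path_tendsto limit_path_nonneg by (simp add: Y_eq)
    have 8: "L 0 \<omega> = 0 \<and> (\<forall>t. point_of_growth (\<lambda>u. L u \<omega>) t \<longrightarrow> Y t \<omega> = 0)"
      using limit_push_growth by (simp add: growth L_eq Y_eq limit_push_0)
    show ?thesis
      using 1 2 4 5 6 7 8 by blast
  qed
  show ?thesis
  proof (intro exI conjI)
    show "AE \<omega> in M. \<forall>t\<ge>0. ((\<lambda>\<epsilon>. Y\<epsilon> \<epsilon> t \<omega>) \<longlongrightarrow> Y t \<omega>) (at_right 0) \<and> Y t \<omega> \<ge> 0"
      using family_AE by eventually_elim (use path in blast)
    show "RFOU_process M H B y0 (b / 2) (\<sigma> / 2) Y L"
      unfolding RFOU_process_def reflection_function_def stochastic_process_def
    proof (intro conjI allI impI)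
      show "fractional_brownian_motion M H B"
        using assms(7,8) by (rule fractional_brownian_motion_modification)
      show "AE \<omega> in M. continuous_on {0..} (\<lambda>t. L t \<omega>) \<and> mono_on {0..} (\<lambda>t. L t \<omega>) \<and>
          L 0 \<omega> = 0 \<and> (\<forall>t. point_of_growth (\<lambda>u. L u \<omega>) t \<longrightarrow> Y t \<omega> = 0)"
        using family_AE by eventually_elim (use path in blast)
      show "AE \<omega> in M. \<forall>t\<ge>0. Y t \<omega> \<ge> 0"
        using family_AE by eventually_elim (use path in blast)
      show "AE \<omega> in M. \<forall>t\<ge>0. (\<lambda>s. Y s \<omega>) integrable_on {0..t} \<and>
          Y t \<omega> = y0 - b / 2 * integral {0..t} (\<lambda>s. Y s \<omega>) + \<sigma> / 2 * B t \<omega> + L t \<omega>"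
        using family_AE by eventually_elim (use path in blast)
    qed (use assms Y_meas L_meas in auto)
    show "AE \<omega> in M. \<forall>T>0.
       ((\<lambda>\<epsilon>. SUP t\<in>{0..T}. \<bar>Y t \<omega> - Y\<epsilon> \<epsilon> t \<omega>\<bar>) \<longlongrightarrow> 0) (at_right 0) \<and>
       ((\<lambda>\<epsilon>. SUP t\<in>{0..T}. \<bar>L t \<omega> - 1/2 * integral {0..t} (\<lambda>s. \<epsilon> / Y\<epsilon> \<epsilon> s \<omega>)\<bar>) \<longlongrightarrow> 0) (at_right 0)"
      using family_AE by eventually_elim (use path in blast)
  qed
qed

end
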